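(* Let $A\in\mathbb{C}^{n\times n}$ have singular value decomposition $A = U\Sigma V^*$, with $U,V$ unitary and $\Sigma=\operatorname{diag}(\sigma_1,\dots,\sigma_n)$, $\sigma_1\geq\sigma_2\geq\dots\geq\sigma_n\geq 0$, and let $k$ be an integer with $0\leq k\leq n$. Let $k_+$ (resp. $k_-$) be the number of singular values of $A$ strictly greater (resp. strictly smaller) than $1$. Let $\hat A= U \widehat{\Sigma} V^*$, where $\widehat{\Sigma}$ is the diagonal matrix with diagonal elements \[ \hat{\sigma}_i = \begin{cases} 1 & \text{if } k< i \leq k_+ \text{ or } n-k_- < i \leq n-k,\\ \sigma_i & \text{otherwise.} \end{cases} \] Then $\hat A\in\mathcal{U}_k$ attains the minimum of $\|A-X\|_F$ over $X\in\mathcal{U}_k$, that is, \[ \min_{X \in \mathcal{U}_k} \|A - X\|_F = \|A-\hat A\|_F, \] and moreover \[ \|A-\hat{A}\|_F^2 = \sum_{i=k+1}^{k_+} (\sigma_i-1)^2 + \sum_{i=n-k_-+1}^{n-k} (\sigma_i-1)^2 . \]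
   Context: $\mathcal{U}_k$ is the set of unitary-plus-rank-$k$ matrices: $X\in\mathbb{C}^{n\times n}$ belongs to $\mathcal{U}_k$ if and only if there exist a unitary matrix $Q\in\mathbb{C}^{n\times n}$ and matrices $G,B\in\mathbb{C}^{n\times k}$ such that $X = Q + GB^*$. $\|\cdot\|_F$ is the Frobenius norm. Singular values are counted with multiplicity. A sum whose lower index exceeds its upper index is empty and equals $0$. *)

theory Defs
  imports "Jordan_Normal_Form.Schur_Decomposition"
begin

definition unitary_mat :: "complex mat \<Rightarrow> bool" where
  "unitary_mat Q \<longleftrightarrow> square_mat Q \<and> mat_adjoint Q * Q = 1\<^sub>m (dim_row Q)"

definition frobenius_norm :: "complex mat \<Rightarrow> real" where
  "frobenius_norm A = sqrt (\<Sum>i<dim_row A. \<Sum>j<dim_col A. (cmod (A $$ (i, j)))\<^sup>2)"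

definition unitary_plus_rank :: "nat \<Rightarrow> nat \<Rightarrow> complex mat set" where
  "unitary_plus_rank n k =
     {X. \<exists>Q G B. Q \<in> carrier_mat n n \<and> unitary_mat Q \<and>
         G \<in> carrier_mat n k \<and> B \<in> carrier_mat n k \<and> X = Q + G * mat_adjoint B}"

(* The sequence s is indexed from 1, whereas matrix entries are indexed from 0. *)
definition diag_of :: "nat \<Rightarrow> (nat \<Rightarrow> real) \<Rightarrow> complex mat" where
  "diag_of n s = mat_diag n (\<lambda>i. complex_of_real (s (Suc i)))"

end

theory Submission
  imports Defs "HOL-Analysis.L2_Norm"
begin

text \<open>
  Multiplication by unitary matrices on the left and on the right preserves both the Frobenius norm
  and the set of unitary-plus-rank-\<open>k\<close> matrices, so \<open>A\<close> may be replaced by the diagonal matrix \<open>D\<close> of its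
  singular values. Two facts about diagonal matrices remain.

  First, a nonnegative diagonal matrix with at most \<open>k\<close> entries above \<open>1\<close> and at most \<open>k\<close> entries below \<open>1\<close>
  is unitary plus rank \<open>k\<close> (\<open>diag_unitary_plus_rank\<close>). Indeed, for \<open>a > 1 > b \<ge> 0\<close> there is a plane
  reflection \<open>R\<close> for which \<open>diag(a, b) - R\<close> is singular, so entries on different sides of \<open>1\<close> can share one
  rank-one correction. The matrix \<open>A_hat\<close> is of this kind: it keeps the \<open>k\<close> largest among the singular
  values above \<open>1\<close> and the \<open>k\<close> smallest among those below \<open>1\<close>, and replaces the others by \<open>1\<close>.

  Second, no \<open>X = Q + G B\<^sup>*\<close> is closer to \<open>D\<close> than the stated sum (\<open>diag_distance_lower_bound\<close>). The
  argument tests \<open>D - X\<close> on orthonormal vectors in the kernel of \<open>B\<^sup>*\<close>, where \<open>X\<close> acts as the isometry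
  \<open>Q\<close>. A count of linear equations provides, for every index \<open>i\<close> of the sum, such a vector in the
  span of the first \<open>i\<close> unit vectors if \<open>\<sigma> i > 1\<close>, and in the span of the unit vectors from the \<open>i\<close>-th on if
  \<open>\<sigma> i < 1\<close>. It is stretched by \<open>D\<close> at least, respectively at most, by the factor \<open>\<sigma> i\<close>, so its image under
  \<open>D - X\<close> has norm at least \<open>|\<sigma> i - 1|\<close>. By Bessel's inequality the squares of these
  norms add up to at most the square of the Frobenius norm. This flag argument bounds the distance
  directly, without comparing the singular values of \<open>D\<close> and \<open>X\<close>.
\<close>

section \<open>Adjoints, unitary matrices and the Frobenius norm\<close>

lemma mat_adjoint_carrier [simp]:
  "A \<in> carrier_mat n m \<Longrightarrow> mat_adjoint A \<in> carrier_mat m n"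
  by (auto simp: mat_adjoint_def)

lemma dim_mat_adjoint [simp]:
  "dim_row (mat_adjoint A) = dim_col A" "dim_col (mat_adjoint A) = dim_row A"
  by (auto simp: mat_adjoint_def)

lemma index_mat_adjoint [simp]:
  fixes A :: "complex mat"
  shows "i < dim_col A \<Longrightarrow> j < dim_row A \<Longrightarrow> mat_adjoint A $$ (i, j) = cnj (A $$ (j, i))"
  by (auto simp: mat_adjoint_def mat_of_rows_index)

lemma mat_adjoint_adjoint [simp]: "mat_adjoint (mat_adjoint A) = (A :: complex mat)"
  by (intro eq_matI) auto

lemma mat_adjoint_mult:
  fixes A B :: "complex mat"
  assumes "A \<in> carrier_mat n m" "B \<in> carrier_mat m l"
  shows "mat_adjoint (A * B) = mat_adjoint B * mat_adjoint A"
  using assms by (intro eq_matI) (auto simp: scalar_prod_def mult.commute)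

definition l2_norm :: "complex vec \<Rightarrow> real" where
  "l2_norm v = L2_set (\<lambda>i. cmod (v $ i)) {..<dim_vec v}"

lemma l2_norm_square: "(l2_norm v)\<^sup>2 = (\<Sum>i<dim_vec v. (cmod (v $ i))\<^sup>2)"
  by (simp add: l2_norm_def L2_set_def sum_nonneg)

lemma of_real_l2_norm_square: "complex_of_real ((l2_norm v)\<^sup>2) = v \<bullet>c v"
  by (simp add: l2_norm_square scalar_prod_def complex_norm_square lessThan_atLeast0 del: of_real_power)

lemma l2_norm_minus_commute:
  "dim_vec v = dim_vec w \<Longrightarrow> l2_norm (v - w) = l2_norm (w - v)"
  unfolding l2_norm_def by (rule L2_set_cong) (auto simp: norm_minus_commute)

lemma l2_norm_triangle_sub:
  assumes "dim_vec v = dim_vec w"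
  shows "l2_norm v - l2_norm w \<le> l2_norm (v - w)"
proof -
  have "l2_norm v \<le> L2_set (\<lambda>i. cmod ((v - w) $ i) + cmod (w $ i)) {..<dim_vec v}"
    unfolding l2_norm_def using assms
    by (intro L2_set_mono) (auto simp: norm_triangle_sub add.commute)
  also have "\<dots> \<le> l2_norm (v - w) + l2_norm w"
    unfolding l2_norm_def using assms L2_set_triangle_ineq by simp
  finally show ?thesis by simp
qed

lemma cscalar_prod_mult_mat_vec:
  fixes A :: "complex mat"
  assumes "A \<in> carrier_mat n m" "v \<in> carrier_vec m" "w \<in> carrier_vec n"
  shows "(A *\<^sub>v v) \<bullet>c w = v \<bullet>c (mat_adjoint A *\<^sub>v w)"
proof -
  have "(A *\<^sub>v v) \<bullet>c w = (\<Sum>i<n. \<Sum>j<m. A $$ (i,j) * v $ j * cnj (w $ i))"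
    using assms by (auto simp: scalar_prod_def sum_distrib_right lessThan_atLeast0 intro!: sum.cong)
  also have "\<dots> = (\<Sum>j<m. \<Sum>i<n. A $$ (i,j) * v $ j * cnj (w $ i))"
    by (rule sum.swap)
  also have "\<dots> = v \<bullet>c (mat_adjoint A *\<^sub>v w)"
    using assms by (auto simp: scalar_prod_def sum_distrib_left lessThan_atLeast0 mult_ac intro!: sum.cong)
  finally show ?thesis .
qed

lemma unitary_mat_isometry:
  assumes "Q \<in> carrier_mat n n" "unitary_mat Q" "v \<in> carrier_vec n"
  shows "l2_norm (Q *\<^sub>v v) = l2_norm v"
proof -
  have "(Q *\<^sub>v v) \<bullet>c (Q *\<^sub>v v) = v \<bullet>c (mat_adjoint Q *\<^sub>v (Q *\<^sub>v v))"
    using assms by (intro cscalar_prod_mult_mat_vec) auto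
  also have "mat_adjoint Q *\<^sub>v (Q *\<^sub>v v) = (mat_adjoint Q * Q) *\<^sub>v v"
    using assms by (intro assoc_mult_mat_vec[symmetric]) auto
  also have "\<dots> = v"
    using assms by (simp add: unitary_mat_def)
  finally have "(l2_norm (Q *\<^sub>v v))\<^sup>2 = (l2_norm v)\<^sup>2"
    by (simp only: of_real_eq_iff flip: of_real_l2_norm_square)
  then show ?thesis
    by (simp add: l2_norm_def)
qed

lemma unitary_mat_adjoint_right:
  assumes "Q \<in> carrier_mat n n" "unitary_mat Q"
  shows "Q * mat_adjoint Q = 1\<^sub>m n"
  using assms by (intro mat_mult_left_right_inverse[of "mat_adjoint Q"]) (auto simp: unitary_mat_def)

lemma unitary_mat_adjoint:
  assumes "Q \<in> carrier_mat n n" "unitary_mat Q"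
  shows "unitary_mat (mat_adjoint Q)"
  using assms unitary_mat_adjoint_right[OF assms] by (auto simp: unitary_mat_def)

lemma unitary_mat_mult:
  assumes "P \<in> carrier_mat n n" "unitary_mat P" "Q \<in> carrier_mat n n" "unitary_mat Q"
  shows "unitary_mat (P * Q)"
proof -
  have "mat_adjoint (P * Q) * (P * Q) = mat_adjoint Q * (mat_adjoint P * P) * Q"
    using assms by (simp add: mat_adjoint_mult[of _ n n _ n] assoc_mult_mat[of _ n n _ n _ n]
        mult_carrier_mat[of _ n n _ n])
  also have "\<dots> = 1\<^sub>m n"
    using assms by (simp add: unitary_mat_def)
  finally show ?thesis
    using assms by (auto simp: unitary_mat_def)
qed

lemma frobenius_norm_nonneg [simp]: "0 \<le> frobenius_norm A"
  by (simp add: frobenius_norm_def sum_nonneg)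

lemma frobenius_norm_square:
  "(frobenius_norm A)\<^sup>2 = (\<Sum>i<dim_row A. \<Sum>j<dim_col A. (cmod (A $$ (i, j)))\<^sup>2)"
  by (simp add: frobenius_norm_def sum_nonneg)

lemma frobenius_norm_square_cols:
  "(frobenius_norm A)\<^sup>2 = (\<Sum>j<dim_col A. (l2_norm (col A j))\<^sup>2)"
  unfolding frobenius_norm_square l2_norm_square by (subst sum.swap) simp

lemma frobenius_norm_adjoint [simp]: "frobenius_norm (mat_adjoint A) = frobenius_norm A"
  unfolding frobenius_norm_def by (subst sum.swap) simp

lemma frobenius_norm_unitary_left:
  assumes "U \<in> carrier_mat n n" "unitary_mat U" "M \<in> carrier_mat n m"
  shows "frobenius_norm (U * M) = frobenius_norm M"
proof -
  have "l2_norm (col (U * M) j) = l2_norm (col M j)" if "j < m" for j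
    using assms that unfolding col_mult2[OF assms(1,3) that]
    by (intro unitary_mat_isometry[OF assms(1,2)]) auto
  then have "(frobenius_norm (U * M))\<^sup>2 = (frobenius_norm M)\<^sup>2"
    unfolding frobenius_norm_square_cols using assms(3) by simp
  then show ?thesis
    by simp
qed

lemma frobenius_norm_unitary_right:
  assumes "V \<in> carrier_mat n n" "unitary_mat V" "M \<in> carrier_mat m n"
  shows "frobenius_norm (M * mat_adjoint V) = frobenius_norm M"
proof -
  have "frobenius_norm (M * mat_adjoint V) = frobenius_norm (mat_adjoint (M * mat_adjoint V))"
    by simp
  also have "mat_adjoint (M * mat_adjoint V) = V * mat_adjoint M"
    using assms by (simp add: mat_adjoint_mult[of _ m n _ n])
  also have "frobenius_norm \<dots> = frobenius_norm M"
    using assms by (simp add: frobenius_norm_unitary_left[of _ n _ m])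
  finally show ?thesis .
qed

section \<open>Bessel's inequality\<close>

text \<open>
  Expand \<open>0 \<le> |r - u|\<^sup>2\<close>, where \<open>u\<close> is the combination of the conjugated \<open>w i\<close> with the
  coefficients \<open>r \<bullet> w i\<close>. The coefficients use the bilinear product, without conjugation,
  because in the application \<open>r\<close> is a row of a matrix that is multiplied with \<open>w i\<close>.
\<close>

lemma bessel_inequality:
  assumes "r \<in> carrier_vec n" "finite I" "\<And>i. i \<in> I \<Longrightarrow> w i \<in> carrier_vec n"
    and on: "\<And>i j. i \<in> I \<Longrightarrow> j \<in> I \<Longrightarrow> w i \<bullet>c w j = (if i = j then 1 else 0)"
  shows "(\<Sum>i\<in>I. (cmod (r \<bullet> w i))\<^sup>2) \<le> (l2_norm r)\<^sup>2"
proof -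
  define c where "c i = r \<bullet> w i" for i
  define u where "u l = (\<Sum>i\<in>I. c i * cnj (w i $ l))" for l
  define S where "S = (\<Sum>i\<in>I. (cmod (c i))\<^sup>2)"
  have c: "c i = (\<Sum>l<n. r $ l * w i $ l)" if "i \<in> I" for i
    using assms(3)[OF that] by (simp add: c_def scalar_prod_def lessThan_atLeast0)
  have w: "(\<Sum>l<n. w i $ l * cnj (w j $ l)) = (if i = j then 1 else 0)" if "i \<in> I" "j \<in> I" for i j
    using assms(3)[OF that(1)] assms(3)[OF that(2)] on[OF that]
    by (simp add: scalar_prod_def lessThan_atLeast0)
  have ru: "(\<Sum>l<n. r $ l * cnj (u l)) = of_real S"
  proof -
    have "(\<Sum>l<n. r $ l * cnj (u l)) = (\<Sum>l<n. \<Sum>i\<in>I. cnj (c i) * (r $ l * w i $ l))"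
      by (simp add: u_def sum_distrib_left mult_ac)
    also have "\<dots> = (\<Sum>i\<in>I. cnj (c i) * (\<Sum>l<n. r $ l * w i $ l))"
      by (subst sum.swap) (simp add: sum_distrib_left)
    also have "\<dots> = (\<Sum>i\<in>I. cnj (c i) * c i)"
      by (simp add: c)
    finally show ?thesis
      by (simp add: S_def complex_norm_square mult.commute del: of_real_power)
  qed
  have uu: "(\<Sum>l<n. u l * cnj (u l)) = of_real S"
  proof -
    have "(\<Sum>l<n. u l * cnj (u l))
        = (\<Sum>l<n. \<Sum>i\<in>I. \<Sum>j\<in>I. c i * cnj (c j) * (w j $ l * cnj (w i $ l)))"
      by (simp add: u_def sum_product mult_ac)
    also have "\<dots> = (\<Sum>i\<in>I. \<Sum>l<n. \<Sum>j\<in>I. c i * cnj (c j) * (w j $ l * cnj (w i $ l)))"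
      by (rule sum.swap)
    also have "\<dots> = (\<Sum>i\<in>I. \<Sum>j\<in>I. \<Sum>l<n. c i * cnj (c j) * (w j $ l * cnj (w i $ l)))"
      by (intro sum.cong refl sum.swap)
    also have "\<dots> = (\<Sum>i\<in>I. \<Sum>j\<in>I. c i * cnj (c j) * (if j = i then 1 else 0))"
      by (simp add: w flip: sum_distrib_left)
    also have "\<dots> = (\<Sum>i\<in>I. c i * cnj (c i))"
      using assms(2) by (simp add: if_distrib cong: if_cong)
    finally show ?thesis
      by (simp add: S_def complex_norm_square del: of_real_power)
  qed
  have rr: "(\<Sum>l<n. r $ l * cnj (r $ l)) = of_real ((l2_norm r)\<^sup>2)"
    using assms(1) by (simp add: l2_norm_square complex_norm_square del: of_real_power)
  have ur: "(\<Sum>l<n. u l * cnj (r $ l)) = of_real S"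
  proof -
    have "(\<Sum>l<n. u l * cnj (r $ l)) = cnj (\<Sum>l<n. r $ l * cnj (u l))"
      by (simp add: mult.commute)
    then show ?thesis
      by (simp add: ru)
  qed
  have "complex_of_real (\<Sum>l<n. (cmod (r $ l - u l))\<^sup>2)
      = (\<Sum>l<n. r $ l * cnj (r $ l) - r $ l * cnj (u l) - u l * cnj (r $ l) + u l * cnj (u l))"
    unfolding of_real_sum complex_norm_square by (intro sum.cong) (auto simp: algebra_simps)
  also have "\<dots> = of_real ((l2_norm r)\<^sup>2 - S)"
    by (simp only: sum.distrib sum_subtractf rr ru ur uu) simp
  finally have "(\<Sum>l<n. (cmod (r $ l - u l))\<^sup>2) = (l2_norm r)\<^sup>2 - S"
    by (simp only: of_real_eq_iff)
  moreover have "0 \<le> (\<Sum>l<n. (cmod (r $ l - u l))\<^sup>2)"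
    by (intro sum_nonneg) simp
  ultimately show ?thesis
    by (simp add: S_def c_def)
qed

text \<open>
  Bessel's inequality for every row of \<open>E\<close>, summed over the rows. All lower bounds on a
  Frobenius norm come from here: it is enough to exhibit orthonormal vectors on which \<open>E\<close> is large.
\<close>

lemma frobenius_norm_ge_orthonormal:
  assumes "E \<in> carrier_mat m n" "finite I" "\<And>i. i \<in> I \<Longrightarrow> w i \<in> carrier_vec n"
    and "\<And>i j. i \<in> I \<Longrightarrow> j \<in> I \<Longrightarrow> w i \<bullet>c w j = (if i = j then 1 else 0)"
  shows "(\<Sum>i\<in>I. (l2_norm (E *\<^sub>v w i))\<^sup>2) \<le> (frobenius_norm E)\<^sup>2"
proof -
  have "(\<Sum>i\<in>I. (l2_norm (E *\<^sub>v w i))\<^sup>2) = (\<Sum>r<m. \<Sum>i\<in>I. (cmod (row E r \<bullet> w i))\<^sup>2)"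
    using assms(1) by (simp add: l2_norm_square) (rule sum.swap)
  also have "\<dots> \<le> (\<Sum>r<m. (l2_norm (row E r))\<^sup>2)"
    using assms by (intro sum_mono bessel_inequality[of _ n]) auto
  also have "\<dots> = (frobenius_norm E)\<^sup>2"
    using assms(1) by (simp add: frobenius_norm_square l2_norm_square)
  finally show ?thesis .
qed

section \<open>Orthonormal vectors subject to linear constraints\<close>

lemma unit_vector_orthogonal_to:
  fixes S :: "complex vec set"
  assumes "finite S" "S \<subseteq> carrier_vec n" "card S < n"
  obtains v where "v \<in> carrier_vec n" "l2_norm v = 1" "\<And>w. w \<in> S \<Longrightarrow> v \<bullet>c w = 0"
proof -
  obtain ws where ws: "set ws = S" "length ws = card S"
    using assms(1) finite_distinct_list distinct_card by metis
  \<comment> \<open>Fewer than \<open>n\<close> equations in \<open>n\<close> unknowns leave at least one zero row in a square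
    coefficient matrix, so that its determinant vanishes and the system has a nonzero solution.\<close>
  define M where "M = mat\<^sub>r n n (\<lambda>i. if i = n - 1 then 0\<^sub>v n
      else if i < length ws then conjugate (ws ! i) else 0\<^sub>v n)"
  have ws_carrier: "ws ! i \<in> carrier_vec n" if "i < length ws" for i
    using that assms(2) ws(1) nth_mem by blast
  have "det M = 0"
    unfolding M_def using assms(3) ws_carrier by (intro det_row_0) auto
  moreover have M: "M \<in> carrier_mat n n"
    by (simp add: M_def)
  ultimately obtain x where x: "x \<in> carrier_vec n" "x \<noteq> 0\<^sub>v n" "M *\<^sub>v x = 0\<^sub>v n"
    using det_0_iff_vec_prod_zero_field by blast
  have x_orth: "x \<bullet>c w = 0" if "w \<in> S" for w
  proof -
    obtain i where i: "i < length ws" "w = ws ! i"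
      using \<open>w \<in> S\<close> in_set_conv_nth[of w ws] unfolding ws(1) by blast
    have "i < n" "i \<noteq> n - 1"
      using i(1) ws(2) assms(3) by auto
    then have "row M i = conjugate w"
      using i ws_carrier[OF i(1)] by (simp add: M_def)
    then have "conjugate w \<bullet> x = (M *\<^sub>v x) $ i"
      using M \<open>i < n\<close> by simp
    then show ?thesis
      using x \<open>i < n\<close> ws_carrier[OF i(1)] i(2) by (simp add: conjugate_vec_sprod_comm)
  qed
  define c where "c = complex_of_real (inverse (l2_norm x))"
  have "x \<bullet>c x \<noteq> 0"
    using x by simp
  then have nz: "l2_norm x \<noteq> 0"
    using of_real_l2_norm_square[of x] by auto
  have "l2_norm (c \<cdot>\<^sub>v x) = cmod c * l2_norm x"
    unfolding l2_norm_def using x(1)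
    by (subst L2_set_right_distrib) (auto simp: norm_mult intro!: L2_set_cong)
  also have "\<dots> = 1"
    using nz by (simp add: c_def l2_norm_def norm_inverse)
  finally have "l2_norm (c \<cdot>\<^sub>v x) = 1" .
  moreover have "(c \<cdot>\<^sub>v x) \<bullet>c w = 0" if "w \<in> S" for w
    using x_orth[OF that] x(1) that assms(2)
    by (auto simp: smult_scalar_prod_distrib[of _ n])
  ultimately show thesis
    using x(1) by (intro that[of "c \<cdot>\<^sub>v x"]) auto
qed

lemma cscalar_prod_commute:
  fixes v w :: "complex vec"
  assumes "v \<in> carrier_vec n" "w \<in> carrier_vec n"
  shows "v \<bullet>c w = cnj (w \<bullet>c v)"
  using assms by (simp add: scalar_prod_def mult.commute)

text \<open>
  The \<open>j\<close>-th vector has to satisfy the constraints \<open>C j\<close> and be orthogonal to the \<open>j\<close> vectors chosen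
  before it. These are fewer than \<open>n\<close> equations as long as \<open>card (C j) + j < n\<close>.
\<close>

lemma orthonormal_selection:
  fixes C :: "nat \<Rightarrow> complex vec set"
  assumes "\<And>j. j < m \<Longrightarrow> finite (C j) \<and> C j \<subseteq> carrier_vec n \<and> card (C j) + j < n"
  shows "\<exists>v. (\<forall>j<m. v j \<in> carrier_vec n \<and> (\<forall>w\<in>C j. v j \<bullet>c w = 0)) \<and>
    (\<forall>i<m. \<forall>j<m. v i \<bullet>c v j = (if i = j then 1 else 0))"
  using assms
proof (induction m)
  case 0
  then show ?case by simp
next
  case (Suc m)
  obtain v where v: "\<forall>j<m. v j \<in> carrier_vec n \<and> (\<forall>w\<in>C j. v j \<bullet>c w = 0)"
      "\<forall>i<m. \<forall>j<m. v i \<bullet>c v j = (if i = j then 1 else 0)"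
    using Suc by (metis less_Suc_eq)
  have C: "finite (C m)" "C m \<subseteq> carrier_vec n" "card (C m) + m < n"
    using Suc.prems[of m] by auto
  have "card (C m \<union> v ` {..<m}) \<le> card (C m) + card (v ` {..<m})"
    by (rule card_Un_le)
  also have "card (v ` {..<m}) \<le> m"
    using card_image_le[of "{..<m}" v] by simp
  finally have "card (C m \<union> v ` {..<m}) < n"
    using C(3) by simp
  then obtain x where x: "x \<in> carrier_vec n" "l2_norm x = 1"
      "\<And>w. w \<in> C m \<union> v ` {..<m} \<Longrightarrow> x \<bullet>c w = 0"
    using unit_vector_orthogonal_to[of "C m \<union> v ` {..<m}" n] C v(1) by blast
  have "x \<bullet>c x = 1"
    using of_real_l2_norm_square[of x] x(2) by simp
  moreover have "v i \<bullet>c x = 0" if "i < m" for i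
    using x(3)[of "v i"] that v(1) x(1) cscalar_prod_commute[of "v i" n x] by simp
  ultimately show ?case
    using v x by (intro exI[of _ "v(m := x)"]) (auto simp: less_Suc_eq)
qed

text \<open>
  The constraints used for a matrix of the form \<open>Q + G B\<^sup>*\<close>: each vector lies in the kernel of
  \<open>B\<^sup>*\<close>, which costs \<open>k\<close> equations, and vanishes at the positions in \<open>S j\<close>.
\<close>

lemma orthonormal_flag_in_kernel:
  fixes B :: "complex mat"
  assumes B: "B \<in> carrier_mat n k"
    and S: "\<And>j. j < m \<Longrightarrow> S j \<subseteq> {..<n} \<and> card (S j) + k + j < n"
  obtains v where "\<And>j. j < m \<Longrightarrow> v j \<in> carrier_vec n"
    "\<And>i j. i < m \<Longrightarrow> j < m \<Longrightarrow> v i \<bullet>c v j = (if i = j then 1 else 0)"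
    "\<And>j. j < m \<Longrightarrow> mat_adjoint B *\<^sub>v v j = 0\<^sub>v k"
    "\<And>j l. j < m \<Longrightarrow> l \<in> S j \<Longrightarrow> v j $ l = 0"
proof -
  define C where "C j = col B ` {..<k} \<union> unit_vec n ` S j" for j
  have "finite (C j) \<and> C j \<subseteq> carrier_vec n \<and> card (C j) + j < n" if "j < m" for j
  proof -
    have "finite (S j)"
      using S[OF that] finite_subset by blast
    moreover from this have "card (C j) \<le> k + card (S j)"
      unfolding C_def using card_image_le[of "{..<k}" "col B"] card_image_le[of "S j" "unit_vec n :: nat \<Rightarrow> complex vec"]
      by (intro order_trans[OF card_Un_le] add_mono) auto
    ultimately show ?thesis
      using S[OF that] B by (auto simp: C_def)
  qed
  then obtain v where v: "\<forall>j<m. v j \<in> carrier_vec n \<and> (\<forall>w\<in>C j. v j \<bullet>c w = 0)"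
    "\<forall>i<m. \<forall>j<m. v i \<bullet>c v j = (if i = j then 1 else 0)"
    using orthonormal_selection[of m C n] by blast
  have ker: "mat_adjoint B *\<^sub>v v j = 0\<^sub>v k" if "j < m" for j
  proof (intro eq_vecI)
    fix i assume "i < dim_vec (0\<^sub>v k :: complex vec)"
    then have i: "i < k"
      by simp
    then have "v j \<bullet>c col B i = 0"
      using v(1) that by (auto simp: C_def)
    moreover have "(mat_adjoint B *\<^sub>v v j) $ i = v j \<bullet>c col B i"
      using v(1) that B i by (auto simp: scalar_prod_def intro!: sum.cong)
    ultimately show "(mat_adjoint B *\<^sub>v v j) $ i = 0\<^sub>v k $ i"
      using i by simp
  qed (use B in auto)
  have "v j $ l = 0" if "j < m" "l \<in> S j" for j l
  proof -
    have l: "l < n"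
      using S that by blast
    have "v j \<bullet>c unit_vec n l = 0"
      using v(1) that by (auto simp: C_def)
    moreover have "conjugate (unit_vec n l) = (unit_vec n l :: complex vec)"
      by (intro eq_vecI) (auto simp: unit_vec_def)
    ultimately show ?thesis
      using v(1) that l by (simp add: scalar_prod_right_unit)
  qed
  then show thesis
    using v ker by (intro that[of v]) auto
qed

section \<open>The lower bound for diagonal matrices\<close>

lemma diag_of_carrier [simp]: "diag_of n \<sigma> \<in> carrier_mat n n"
  by (simp add: diag_of_def)

lemma l2_norm_diag_mult:
  assumes "v \<in> carrier_vec n"
  shows "l2_norm (diag_of n \<sigma> *\<^sub>v v) = L2_set (\<lambda>l. \<bar>\<sigma> (Suc l)\<bar> * cmod (v $ l)) {..<n}"
proof -
  have "(diag_of n \<sigma> *\<^sub>v v) $ l = of_real (\<sigma> (Suc l)) * v $ l" if "l < n" for l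
    using assms that
    by (simp add: diag_of_def mat_diag_def scalar_prod_def) (subst sum.remove[of _ l], auto)
  moreover have "dim_vec (diag_of n \<sigma> *\<^sub>v v) = n"
    by (simp add: diag_of_def mat_diag_def)
  ultimately show ?thesis
    unfolding l2_norm_def by (intro L2_set_cong) (auto simp: norm_mult)
qed

lemma l2_norm_diag_ge:
  assumes "v \<in> carrier_vec n" "0 \<le> s" "\<And>l. l < n \<Longrightarrow> v $ l \<noteq> 0 \<Longrightarrow> s \<le> \<bar>\<sigma> (Suc l)\<bar>"
  shows "s * l2_norm v \<le> l2_norm (diag_of n \<sigma> *\<^sub>v v)"
proof -
  have "s * cmod (v $ l) \<le> \<bar>\<sigma> (Suc l)\<bar> * cmod (v $ l)" if "l < n" for l
    using assms(3)[OF that] by (cases "v $ l = 0") (auto intro!: mult_right_mono)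
  then show ?thesis
    unfolding l2_norm_diag_mult[OF assms(1)] unfolding l2_norm_def using assms(1,2)
    by (auto simp: L2_set_right_distrib intro!: L2_set_mono)
qed

lemma l2_norm_diag_le:
  assumes "v \<in> carrier_vec n" "0 \<le> s" "\<And>l. l < n \<Longrightarrow> v $ l \<noteq> 0 \<Longrightarrow> \<bar>\<sigma> (Suc l)\<bar> \<le> s"
  shows "l2_norm (diag_of n \<sigma> *\<^sub>v v) \<le> s * l2_norm v"
proof -
  have "\<bar>\<sigma> (Suc l)\<bar> * cmod (v $ l) \<le> s * cmod (v $ l)" if "l < n" for l
    using assms(3)[OF that] by (cases "v $ l = 0") (auto intro!: mult_right_mono)
  then show ?thesis
    unfolding l2_norm_diag_mult[OF assms(1)] unfolding l2_norm_def using assms(1,2)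
    by (auto simp: L2_set_right_distrib intro!: L2_set_mono)
qed

text \<open>
  Write \<open>X = Q + G B\<^sup>*\<close>. On unit vectors \<open>v\<close> in the kernel of \<open>B\<^sup>*\<close> the matrix \<open>X\<close> agrees with the
  isometry \<open>Q\<close>, whence \<open>|(D - X) v| \<ge> | |D v| - 1 |\<close> for \<open>D = diag(\<sigma>)\<close>. For \<open>k < i \<le> p\<close> there is such a \<open>v\<close>
  supported on the first \<open>i\<close> coordinates and orthogonal to the \<open>i - k - 1\<close> vectors chosen before: the
  equations number \<open>k + (n - i) + (i - k - 1) = n - 1\<close>. On this support the diagonal entries are at least
  \<open>\<sigma> i \<ge> 1\<close>, so \<open>|D v| - 1 \<ge> \<sigma> i - 1\<close>. Symmetrically, for \<open>n - q < i \<le> n - k\<close> the vector is supported on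
  the last \<open>n - i + 1\<close> coordinates, and \<open>1 - |D v| \<ge> 1 - \<sigma> i\<close>. The two families have disjoint supports
  because \<open>p + q \<le> n\<close>, so together they are orthonormal, and Bessel's inequality adds up the bounds.
\<close>

lemma diag_distance_lower_bound:
  assumes X: "X \<in> unitary_plus_rank n k"
    and anti: "\<And>i j. 1 \<le> i \<Longrightarrow> i \<le> j \<Longrightarrow> j \<le> n \<Longrightarrow> \<sigma> j \<le> \<sigma> i"
    and nonneg: "\<And>i. i \<in> {1..n} \<Longrightarrow> 0 \<le> \<sigma> i"
    and pq: "p + q \<le> n"
    and large: "\<And>i. i \<in> {1..p} \<Longrightarrow> 1 \<le> \<sigma> i"
    and small: "\<And>i. i \<in> {n-q+1..n} \<Longrightarrow> \<sigma> i \<le> 1"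
  shows "(\<Sum>i=k+1..p. (\<sigma> i - 1)\<^sup>2) + (\<Sum>i=n-q+1..n-k. (\<sigma> i - 1)\<^sup>2)
    \<le> (frobenius_norm (diag_of n \<sigma> - X))\<^sup>2"
proof -
  obtain Q G B where Q: "Q \<in> carrier_mat n n" "unitary_mat Q"
    and GB: "G \<in> carrier_mat n k" "B \<in> carrier_mat n k" and XQ: "X = Q + G * mat_adjoint B"
    using X by (auto simp: unitary_plus_rank_def)
  define D where "D = diag_of n \<sigma>"
  have D: "D \<in> carrier_mat n n"
    by (simp add: D_def)
  have E: "D - X \<in> carrier_mat n n"
    using Q GB unfolding XQ by (intro minus_carrier_mat add_carrier_mat mult_carrier_mat) auto
  have gap: "\<bar>l2_norm (D *\<^sub>v v) - 1\<bar> \<le> l2_norm ((D - X) *\<^sub>v v)"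
    if v: "v \<in> carrier_vec n" "l2_norm v = 1" "mat_adjoint B *\<^sub>v v = 0\<^sub>v k" for v
  proof -
    have "X *\<^sub>v v = Q *\<^sub>v v + G *\<^sub>v (mat_adjoint B *\<^sub>v v)"
      unfolding XQ using Q GB v(1)
      by (simp add: add_mult_distrib_mat_vec[of _ n n] assoc_mult_mat_vec[of _ n k _ n]
          mult_carrier_mat[of _ n k _ n])
    also have "\<dots> = Q *\<^sub>v v"
    proof -
      have "G *\<^sub>v 0\<^sub>v k = 0\<^sub>v n"
        using GB by (intro eq_vecI) auto
      then show ?thesis
        using Q v by simp
    qed
    finally have "(D - X) *\<^sub>v v = D *\<^sub>v v - Q *\<^sub>v v"
      using D Q GB v(1) XQ by (subst minus_mult_distrib_mat_vec) auto
    moreover have "l2_norm (Q *\<^sub>v v) = 1"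
      using unitary_mat_isometry[OF Q v(1)] v(2) by simp
    ultimately show ?thesis
      using l2_norm_triangle_sub[of "D *\<^sub>v v" "Q *\<^sub>v v"] l2_norm_triangle_sub[of "Q *\<^sub>v v" "D *\<^sub>v v"]
        l2_norm_minus_commute[of "D *\<^sub>v v" "Q *\<^sub>v v"] D Q by simp
  qed
  \<comment> \<open>The vector for index \<open>i\<close> is \<open>v (i - k - 1)\<close>. Positions count from 0,
    so the first \<open>i\<close> coordinates are those below \<open>k + j + 1\<close> for \<open>j = i - k - 1\<close>.\<close>
  obtain v where v: "\<And>j. j < p - k \<Longrightarrow> v j \<in> carrier_vec n"
    "\<And>i j. i < p - k \<Longrightarrow> j < p - k \<Longrightarrow> v i \<bullet>c v j = (if i = j then 1 else 0)"
    "\<And>j. j < p - k \<Longrightarrow> mat_adjoint B *\<^sub>v v j = 0\<^sub>v k"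
    "\<And>j l. j < p - k \<Longrightarrow> l \<in> {k+j+1..<n} \<Longrightarrow> v j $ l = 0"
    using pq by (rule_tac orthonormal_flag_in_kernel[OF GB(2), of "p - k" "\<lambda>j. {k+j+1..<n}"]) auto
  \<comment> \<open>Here the choice starts at the index \<open>n - k\<close> and goes down: index \<open>i\<close> gets \<open>u (n - k - i)\<close>.\<close>
  obtain u where u: "\<And>j. j < q - k \<Longrightarrow> u j \<in> carrier_vec n"
    "\<And>i j. i < q - k \<Longrightarrow> j < q - k \<Longrightarrow> u i \<bullet>c u j = (if i = j then 1 else 0)"
    "\<And>j. j < q - k \<Longrightarrow> mat_adjoint B *\<^sub>v u j = 0\<^sub>v k"
    "\<And>j l. j < q - k \<Longrightarrow> l \<in> {..<n-k-j-1} \<Longrightarrow> u j $ l = 0"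
    using pq by (rule_tac orthonormal_flag_in_kernel[OF GB(2), of "q - k" "\<lambda>j. {..<n-k-j-1}"]) auto
  have unit: "l2_norm x = 1" if "x \<bullet>c x = 1" for x
    using that of_real_l2_norm_square[of x] L2_set_nonneg
    by (metis l2_norm_def of_real_eq_1_iff power2_eq_1_iff zero_neq_neg_one neg_0_le_iff_le not_one_le_zero)
  define w where "w i = (if i \<le> p then v (i - k - 1) else u (n - k - i))" for i
  let ?P = "{k+1..p}" and ?N = "{n-q+1..n-k}"
  have wP: "w i = v (i - k - 1)" "i - k - 1 < p - k" if "i \<in> ?P" for i
    using that by (auto simp: w_def)
  have wN: "w i = u (n - k - i)" "n - k - i < q - k" if "i \<in> ?N" for i
    using that pq by (auto simp: w_def)
  have w: "w i \<in> carrier_vec n" "w i \<bullet>c w i = 1" "mat_adjoint B *\<^sub>v w i = 0\<^sub>v k" 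
    if "i \<in> ?P \<union> ?N" for i
    using that wP wN v u by auto
  have supP: "l < i" if "i \<in> ?P" "l < n" "w i $ l \<noteq> 0" for i l
    using that wP[OF that(1)] v(4)[of "i - k - 1" l] by (cases "l < i") auto
  have supN: "i \<le> Suc l" if "i \<in> ?N" "l < n" "w i $ l \<noteq> 0" for i l
  proof (rule ccontr)
    assume "\<not> i \<le> Suc l"
    then have "l \<in> {..<n - k - (n - k - i) - 1}"
      using that(1) by auto
    then show False
      using wN[OF that(1)] u(4)[of "n - k - i" l] that(3) by simp
  qed
  have PN: "w i \<bullet>c w j = 0" if "i \<in> ?P" "j \<in> ?N" for i j
  proof -
    have "w i $ l = 0 \<or> w j $ l = 0" if "l < n" for l
      using supP[OF \<open>i \<in> ?P\<close> that] supN[OF \<open>j \<in> ?N\<close> that] \<open>i \<in> ?P\<close> \<open>j \<in> ?N\<close> pq by fastforce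
    then show ?thesis
      using w(1)[of i] w(1)[of j] that by (auto simp: scalar_prod_def intro!: sum.neutral)
  qed
  have on: "w i \<bullet>c w j = (if i = j then 1 else 0)" if ij: "i \<in> ?P \<union> ?N" "j \<in> ?P \<union> ?N" for i j
  proof -
    have "?P \<inter> ?N = {}"
      using pq by auto
    then consider "i \<in> ?P" "j \<in> ?P" | "i \<in> ?N" "j \<in> ?N" | "i \<in> ?P" "j \<in> ?N" "i \<noteq> j" | "i \<in> ?N" "j \<in> ?P" "i \<noteq> j"
      using ij by blast
    then show ?thesis
    proof cases
      case 1
      moreover from this have "i - k - 1 = j - k - 1 \<longleftrightarrow> i = j"
        by auto
      ultimately show ?thesis
        using wP v(2) by simp
    next
      case 2
      moreover from this have "n - k - i = n - k - j \<longleftrightarrow> i = j"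
        by auto
      ultimately show ?thesis
        using wN u(2) by simp
    next
      case 3
      then show ?thesis
        using PN by simp
    next
      case 4
      then show ?thesis
        using PN cscalar_prod_commute[of "w i" n "w j"] w(1) by auto
    qed
  qed
  have bound: "(\<sigma> i - 1)\<^sup>2 \<le> (l2_norm ((D - X) *\<^sub>v w i))\<^sup>2" if i: "i \<in> ?P \<union> ?N" for i
  proof -
    note wi = w(1)[OF i] unit[OF w(2)[OF i]] w(3)[OF i]
    have "\<bar>\<sigma> i - 1\<bar> \<le> \<bar>l2_norm (D *\<^sub>v w i) - 1\<bar>"
    proof (cases "i \<in> ?P")
      case True
      have "\<sigma> i \<le> \<bar>\<sigma> (Suc l)\<bar>" if "l < n" "w i $ l \<noteq> 0" for l
        using supP[OF True that] True pq anti[of "Suc l" i] by auto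
      then have "\<sigma> i \<le> l2_norm (D *\<^sub>v w i)"
        unfolding D_def using l2_norm_diag_ge[OF wi(1), of "\<sigma> i" \<sigma>] wi(2) nonneg[of i] True pq by simp
      then show ?thesis
        using large[of i] True by auto
    next
      case False
      then have N: "i \<in> ?N"
        using i by blast
      have "\<bar>\<sigma> (Suc l)\<bar> \<le> \<sigma> i" if "l < n" "w i $ l \<noteq> 0" for l
        using supN[OF N that] N that nonneg[of "Suc l"] anti[of i "Suc l"] by auto
      then have "l2_norm (D *\<^sub>v w i) \<le> \<sigma> i"
        unfolding D_def using l2_norm_diag_le[OF wi(1), of "\<sigma> i" \<sigma>] wi(2) nonneg[of i] N by fastforce
      then show ?thesis
        using small[of i] N by auto
    qed
    also have "\<dots> \<le> l2_norm ((D - X) *\<^sub>v w i)"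
      by (rule gap[OF wi])
    finally show ?thesis
      by (metis abs_ge_zero power2_abs power_mono)
  qed
  have "(\<Sum>i\<in>?P. (\<sigma> i - 1)\<^sup>2) + (\<Sum>i\<in>?N. (\<sigma> i - 1)\<^sup>2) = (\<Sum>i\<in>?P\<union>?N. (\<sigma> i - 1)\<^sup>2)"
    using pq by (intro sum.union_disjoint[symmetric]) auto
  also have "\<dots> \<le> (\<Sum>i\<in>?P\<union>?N. (l2_norm ((D - X) *\<^sub>v w i))\<^sup>2)"
    by (intro sum_mono bound)
  also have "\<dots> \<le> (frobenius_norm (D - X))\<^sup>2"
    using on w(1) by (intro frobenius_norm_ge_orthonormal[OF E]) auto
  finally show ?thesis
    by (simp add: D_def)
qed

section \<open>Unitary-plus-rank-k matrices\<close>

lemma unitary_plus_rank_carrier: "X \<in> unitary_plus_rank n k \<Longrightarrow> X \<in> carrier_mat n n"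
  by (auto simp: unitary_plus_rank_def)

lemma unitary_plus_rankI:
  assumes "Q \<in> carrier_mat n n" "unitary_mat Q" "G \<in> carrier_mat n k" "B \<in> carrier_mat n k"
  shows "Q + G * mat_adjoint B \<in> unitary_plus_rank n k"
  using assms unfolding unitary_plus_rank_def by blast

lemma unitary_plus_rank_mult:
  assumes P: "P \<in> carrier_mat n n" "unitary_mat P"
    and R: "R \<in> carrier_mat n n" "unitary_mat R"
    and X: "X \<in> unitary_plus_rank n k"
  shows "P * X * R \<in> unitary_plus_rank n k"
proof -
  obtain Q G B where Q: "Q \<in> carrier_mat n n" "unitary_mat Q"
    and G: "G \<in> carrier_mat n k" and B: "B \<in> carrier_mat n k" and XQ: "X = Q + G * mat_adjoint B"
    using X by (auto simp: unitary_plus_rank_def)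
  have Ba: "mat_adjoint B \<in> carrier_mat k n"
    using B by simp
  have "P * X * R = (P * Q + P * (G * mat_adjoint B)) * R"
    unfolding XQ using P Q G Ba by (subst mult_add_distrib_mat[of _ n n]) auto
  also have "\<dots> = P * Q * R + P * (G * mat_adjoint B) * R"
    using P Q G Ba R by (subst add_mult_distrib_mat[of _ n n]) auto
  also have "P * (G * mat_adjoint B) * R = (P * G) * (mat_adjoint B * R)"
    using P G Ba R by (simp add: assoc_mult_mat[of _ n n _ k _ n] assoc_mult_mat[of _ n n _ n _ n] assoc_mult_mat[of _ n k _ n _ n]
        mult_carrier_mat[of _ n k _ n] mult_carrier_mat[of _ k n _ n])
  also have "mat_adjoint B * R = mat_adjoint (mat_adjoint R * B)"
    using R B by (simp add: mat_adjoint_mult[of _ n n _ k])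
  finally have "P * X * R = P * Q * R + (P * G) * mat_adjoint (mat_adjoint R * B)" .
  moreover have "unitary_mat (P * Q * R)"
    using P Q R by (intro unitary_mat_mult[of _ n]) auto
  ultimately show ?thesis
    using P Q R G B
    by (metis mat_adjoint_carrier mult_carrier_mat unitary_plus_rankI)
qed

text \<open>
  A diagonal matrix is written as \<open>Q + G G\<^sup>T\<close>, where \<open>Q\<close> is real symmetric with \<open>Q\<^sup>2 = I\<close>. The involution
  \<open>\<pi>\<close> pairs up coordinates. \<open>Q\<close> has diagonal \<open>q\<close>, with values \<open>1\<close> or \<open>-1\<close> at the fixed points of \<open>\<pi>\<close>, and on a
  pair it is a reflection \<open>[[q i, y], [y, - q i]]\<close>. The hypothesis on pairs says that
  \<open>y\<^sup>2 = (d i - q i) (d (\<pi> i) - q (\<pi> i))\<close>, that is, that the block of \<open>diag(d) - Q\<close> is singular.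
  This difference then has, with \<open>g i = \<surd>(d i - q i)\<close>, the entries \<open>g i * g j\<close> inside a block of \<open>\<pi>\<close> and zero
  elsewhere. Each block has rank at most one and occupies a single column of \<open>G\<close>,
  with number \<open>c i\<close>.
\<close>

lemma diag_unitary_plus_rank_of_involution:
  fixes d q :: "nat \<Rightarrow> real" and \<pi> c :: "nat \<Rightarrow> nat"
  assumes \<pi>: "\<And>i. i < n \<Longrightarrow> \<pi> i < n" "\<And>i. i < n \<Longrightarrow> \<pi> (\<pi> i) = i"
    and anti: "\<And>i. i < n \<Longrightarrow> \<pi> i \<noteq> i \<Longrightarrow> q (\<pi> i) = - q i"
    and fixed: "\<And>i. i < n \<Longrightarrow> \<pi> i = i \<Longrightarrow> (q i)\<^sup>2 = 1"
    and paired: "\<And>i. i < n \<Longrightarrow> \<pi> i \<noteq> i \<Longrightarrow> (d i - q i) * (d (\<pi> i) - q (\<pi> i)) = 1 - (q i)\<^sup>2"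
    and ge: "\<And>i. i < n \<Longrightarrow> q i \<le> d i"
    and c_less: "\<And>i. i < n \<Longrightarrow> d i \<noteq> q i \<Longrightarrow> c i < k"
    and c_eq: "\<And>i j. i < n \<Longrightarrow> j < n \<Longrightarrow> d i \<noteq> q i \<Longrightarrow> d j \<noteq> q j \<Longrightarrow> c i = c j \<longleftrightarrow> j = i \<or> j = \<pi> i"
  shows "mat_diag n (\<lambda>i. complex_of_real (d i)) \<in> unitary_plus_rank n k"
proof -
  define g where "g i = sqrt (d i - q i)" for i
  have g_zero: "g i = 0 \<longleftrightarrow> d i = q i" for i
    by (simp add: g_def)
  have g_square: "g i * g i = d i - q i" if "i < n" for i
    using ge[OF that] by (simp add: g_def)
  define Q where "Q = mat n n (\<lambda>(i, j). complex_of_real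
      (if j = i then q i else if j = \<pi> i then - (g i * g j) else 0))"
  define G where "G = mat n k (\<lambda>(i, l). complex_of_real (if c i = l then g i else 0))"
  have "mat_adjoint Q * Q = 1\<^sub>m n"
  proof (intro eq_matI)
    fix i j assume "i < dim_row (1\<^sub>m n :: complex mat)" "j < dim_col (1\<^sub>m n :: complex mat)"
    then have ij: "i < n" "j < n"
      by auto
    define t where "t l = (if i = l then q l else if i = \<pi> l then - (g l * g i) else 0)
        * (if j = l then q l else if j = \<pi> l then - (g l * g j) else 0)" for l
    have "(mat_adjoint Q * Q) $$ (i, j) = of_real (\<Sum>l<n. t l)"
      using ij by (auto simp: Q_def scalar_prod_def t_def lessThan_atLeast0 intro!: sum.cong)
    also have "(\<Sum>l<n. t l) = (\<Sum>l\<in>{i, \<pi> i}. t l)"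
      using ij \<pi>[of i] \<pi>(2) by (intro sum.mono_neutral_right) (auto simp: t_def)
    also have "\<dots> = (if i = j then 1 else 0)"
    proof (cases "\<pi> i = i")
      case True
      then show ?thesis
        using fixed[OF ij(1)] \<pi>(2)[OF ij(2)] by (auto simp: t_def power2_eq_square)
    next
      case False
      have "g i * g i * (g (\<pi> i) * g (\<pi> i)) = 1 - (q i)\<^sup>2"
        using paired[OF ij(1) False] \<pi>(1)[OF ij(1)] ij by (simp add: g_square)
      then have "q i * q i + g (\<pi> i) * g i * (g (\<pi> i) * g i) = 1"
        by (simp add: power2_eq_square algebra_simps)
      then show ?thesis
        using False anti[OF ij(1) False] \<pi>(2)[OF ij(1)] \<pi>(2)[OF ij(2)]
        by (auto simp: t_def algebra_simps)
    qed
    finally show "(mat_adjoint Q * Q) $$ (i, j) = 1\<^sub>m n $$ (i, j)"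
      using ij by simp
  qed (auto simp: Q_def)
  then have "unitary_mat Q"
    by (simp add: unitary_mat_def Q_def)
  moreover have "mat_diag n (\<lambda>i. complex_of_real (d i)) = Q + G * mat_adjoint G"
  proof (intro eq_matI)
    fix i j assume "i < dim_row (Q + G * mat_adjoint G)" "j < dim_col (Q + G * mat_adjoint G)"
    then have ij: "i < n" "j < n"
      by (auto simp: G_def)
    have "(G * mat_adjoint G) $$ (i, j)
        = of_real (\<Sum>l<k. (if c i = l then g i else 0) * (if c j = l then g j else 0))"
      using ij by (auto simp: G_def scalar_prod_def lessThan_atLeast0 intro!: sum.cong)
    also have "(\<Sum>l<k. (if c i = l then g i else 0) * (if c j = l then g j else 0))
        = (\<Sum>l<k. if l = c i then g i * (if c j = c i then g j else 0) else 0)"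
      by (intro sum.cong) auto
    also have "\<dots> = (if c i < k then g i * (if c j = c i then g j else 0) else 0)"
      by (subst sum.delta) auto
    also have "\<dots> = (if j = i \<or> j = \<pi> i then g i * g j else 0)"
      using c_less[OF ij(1)] c_eq[OF ij] g_zero[of i] g_zero[of j] by auto
    finally have "(G * mat_adjoint G) $$ (i, j) = of_real (if j = i \<or> j = \<pi> i then g i * g j else 0)" .
    then show "mat_diag n (\<lambda>i. complex_of_real (d i)) $$ (i, j) = (Q + G * mat_adjoint G) $$ (i, j)"
      using ij g_square[OF ij(1)] by (auto simp: mat_diag_def Q_def G_def simp flip: of_real_mult of_real_add)
  qed (auto simp: G_def mat_diag_def)
  ultimately show ?thesis
    using unitary_plus_rankI[of Q n G k G] by (simp add: Q_def G_def)
qed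

text \<open>
  For \<open>a \<noteq> b\<close>, the value of \<open>x\<close> for which \<open>diag(a, b)\<close> minus the reflection \<open>[[x, y], [y, -x]]\<close>,
  where \<open>x\<^sup>2 + y\<^sup>2 = 1\<close>, is singular: the determinant of the difference is \<open>a b + (a - b) x - 1\<close>.
\<close>

definition reflection_cosine :: "real \<Rightarrow> real \<Rightarrow> real" where
  "reflection_cosine a b = (1 - a * b) / (a - b)"

lemma reflection_cosine_props:
  assumes "1 < a" "0 \<le> b" "b < 1"
  shows "reflection_cosine a b \<le> a" "- reflection_cosine a b \<le> b"
    "(a - reflection_cosine a b) * (b + reflection_cosine a b) = 1 - (reflection_cosine a b)\<^sup>2"
proof -
  define x where "x = reflection_cosine a b"
  have ab: "a - b > 0"
    using assms by simp
  then have x: "x * (a - b) = 1 - a * b"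
    by (simp add: x_def reflection_cosine_def)
  have "1 * 1 \<le> a * a"
    using assms by (intro mult_mono) auto
  then show "x \<le> a"
    using ab by (simp add: x_def reflection_cosine_def pos_divide_le_eq algebra_simps)
  have "b * b \<le> 1 * 1"
    using assms by (intro mult_mono) auto
  then show "- x \<le> b"
    using ab by (simp add: x_def reflection_cosine_def minus_divide_left pos_divide_le_eq algebra_simps)
  show "(a - x) * (b + x) = 1 - x\<^sup>2"
    using x by (simp add: power2_eq_square algebra_simps)
qed

text \<open>
  One rank-one correction repairs an entry above \<open>1\<close> and an entry below \<open>1\<close> at the same time. This is why
  \<open>k\<close> entries on either side of \<open>1\<close> are allowed, and not \<open>k\<close> in total. The entry at
  position \<open>i\<close> is paired with the one at \<open>n - 1 - i\<close> as long as both sides last. The remaining entries of the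
  longer side are treated alone, with \<open>q i = 1\<close> above \<open>1\<close> and \<open>q i = -1\<close> below.
\<close>

lemma diag_unitary_plus_rank:
  fixes d :: "nat \<Rightarrow> real"
  assumes "p \<le> k" "m \<le> k" "p + m \<le> n"
    and large: "\<And>i. i < p \<Longrightarrow> 1 < d i"
    and small: "\<And>i. n - m \<le> i \<Longrightarrow> i < n \<Longrightarrow> 0 \<le> d i \<and> d i < 1"
    and one: "\<And>i. p \<le> i \<Longrightarrow> i < n - m \<Longrightarrow> d i = 1"
  shows "mat_diag n (\<lambda>i. complex_of_real (d i)) \<in> unitary_plus_rank n k"
proof -
  define h where "h = min p m"
  define x where "x i = reflection_cosine (d i) (d (n - 1 - i))" for i
  define \<pi> where "\<pi> i = (if i < h \<or> n - h \<le> i then n - 1 - i else i)" for i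
  define q where "q i = (if i < h then x i else if n - h \<le> i then - x (n - 1 - i)
      else if n - m \<le> i then - 1 else 1)" for i
  \<comment> \<open>Mirror positions share a column only when they are paired: if \<open>p\<close> exceeds \<open>n / 2\<close>, then some
    \<open>i\<close> and \<open>n - 1 - i\<close> both lie below \<open>p\<close> and keep separate columns.\<close>
  define c where "c i = (if i < p then i else n - 1 - i)" for i
  have h: "h \<le> p" "h \<le> m" "h + h \<le> n" "h = p \<or> h = m"
    using assms(3) by (auto simp: h_def)
  have x: "x i \<le> d i" "- x i \<le> d (n - 1 - i)" "(d i - x i) * (d (n - 1 - i) + x i) = 1 - (x i)\<^sup>2"
    if "i < h" for i
    using reflection_cosine_props[of "d i" "d (n - 1 - i)"] large[of i] small[of "n - 1 - i"] that h assms(3)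
    by (auto simp: x_def)
  have reflect: "n - 1 - i < h" "n - 1 - (n - 1 - i) = i" "\<not> i < h" if "n - h \<le> i" "i < n" for i
    using that h by auto
  have reflect': "n - h \<le> n - 1 - i" "n - 1 - i < n" "n - 1 - (n - 1 - i) = i" "\<not> n - 1 - i < h" if "i < h" for i
    using that h by auto
  have outside: "p \<le> i \<Longrightarrow> i < n - m \<Longrightarrow> d i = q i" for i
    using one[of i] h by (auto simp: q_def)
  have supp: "i < p \<or> n - m \<le> i" if "d i \<noteq> q i" for i
    using outside[of i] that by linarith
  show ?thesis
  proof (rule diag_unitary_plus_rank_of_involution[where \<pi> = \<pi> and q = q and c = c])
    fix i assume i: "i < n"
    show "\<pi> i < n" "\<pi> (\<pi> i) = i"
      using i h reflect[of i] reflect'[of i] by (auto simp: \<pi>_def)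
    show "q (\<pi> i) = - q i" if "\<pi> i \<noteq> i"
      using that i reflect[of i] reflect'[of i] by (auto simp: \<pi>_def q_def split: if_splits)
    show "(q i)\<^sup>2 = 1" if "\<pi> i = i"
      using that i reflect[of i] reflect'[of i] by (auto simp: \<pi>_def q_def split: if_splits)
    show "(d i - q i) * (d (\<pi> i) - q (\<pi> i)) = 1 - (q i)\<^sup>2" if "\<pi> i \<noteq> i"
      using that i reflect[of i] reflect'[of i] x(3)[of i] x(3)[of "n - 1 - i"]
      by (auto simp: \<pi>_def q_def mult.commute split: if_splits)
    have "1 \<le> d i" if "i < n - m"
      using large[of i] one[of i] that by (cases "i < p") auto
    then show "q i \<le> d i"
      using i reflect[of i] reflect'[of i] x(1)[of i] x(2)[of "n - 1 - i"] large[of i] small[of i] one[of i] h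
      by (auto simp: q_def not_less not_le)
    show "c i < k" if "d i \<noteq> q i"
      using supp[OF that] i assms by (auto simp: c_def)
    fix j assume j: "j < n"
    show "c i = c j \<longleftrightarrow> j = i \<or> j = \<pi> i" if "d i \<noteq> q i" "d j \<noteq> q j"
      using supp[OF that(1)] supp[OF that(2)] i j h assms(3) by (auto simp: c_def \<pi>_def)
  qed
qed

section \<open>The nearest unitary-plus-rank-k matrix\<close>

lemma downward_closed_eq_atLeastAtMost_card:
  fixes S :: "nat set"
  assumes "S \<subseteq> {1..n}" "\<And>i j. 1 \<le> i \<Longrightarrow> i \<le> j \<Longrightarrow> j \<in> S \<Longrightarrow> i \<in> S"
  shows "S = {1..card S}"
proof (cases "S = {}")
  case False
  have "finite S"
    using assms(1) finite_subset by blast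
  have "S = {1..Max S}"
  proof (intro equalityI subsetI)
    fix i assume "i \<in> {1..Max S}"
    then show "i \<in> S"
      using assms(2)[of i "Max S"] Max_in[OF \<open>finite S\<close> False] by simp
  qed (use \<open>finite S\<close> assms(1) in auto)
  then show ?thesis
    by (metis card_atLeastAtMost diff_Suc_1)
qed simp

lemma upward_closed_eq_atLeastAtMost_card:
  fixes S :: "nat set"
  assumes "S \<subseteq> {1..n}" "\<And>i j. i \<in> S \<Longrightarrow> i \<le> j \<Longrightarrow> j \<le> n \<Longrightarrow> j \<in> S"
  shows "S = {n - card S + 1..n}"
proof -
  have "{1..n} - S = {1..card ({1..n} - S)}"
    using assms by (intro downward_closed_eq_atLeastAtMost_card[of _ n]) auto
  also have "card ({1..n} - S) = n - card S"
    using assms(1) by (simp add: card_Diff_subset finite_subset)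
  finally have "{1..n} - S = {1..n - card S}" .
  moreover have "S = {1..n} - ({1..n} - S)"
    using assms(1) by blast
  moreover have "{1..n} - {1..n - card S} = {n - card S + 1..n}"
    by auto
  ultimately show ?thesis
    by (simp only:)
qed

lemma frobenius_norm_diag_diff_square:
  "(frobenius_norm (diag_of n \<sigma> - diag_of n \<tau>))\<^sup>2 = (\<Sum>i=1..n. (\<sigma> i - \<tau> i)\<^sup>2)"
proof -
  have "(frobenius_norm (diag_of n \<sigma> - diag_of n \<tau>))\<^sup>2
      = (\<Sum>i<n. \<Sum>j<n. if j = i then (\<sigma> (Suc i) - \<tau> (Suc i))\<^sup>2 else 0)"
    unfolding frobenius_norm_square
  proof (intro sum.cong)
    fix i j assume "i \<in> {..<n}" "j \<in> {..<n}"
    moreover have "cmod (of_real a - of_real b) ^ 2 = (a - b)\<^sup>2" for a b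
      by (simp flip: of_real_diff)
    ultimately show "(cmod ((diag_of n \<sigma> - diag_of n \<tau>) $$ (i, j)))\<^sup>2
        = (if j = i then (\<sigma> (Suc i) - \<tau> (Suc i))\<^sup>2 else 0)"
      by (simp add: diag_of_def mat_diag_def)
  qed (auto simp: diag_of_def mat_diag_def)
  also have "\<dots> = (\<Sum>i<n. (\<sigma> (Suc i) - \<tau> (Suc i))\<^sup>2)"
    by simp
  also have "\<dots> = (\<Sum>i=1..n. (\<sigma> i - \<tau> i)\<^sup>2)"
    by (simp add: sum.atLeast1_atMost_eq)
  finally show ?thesis .
qed

lemma frobenius_norm_unitary_equivalence:
  assumes U: "U \<in> carrier_mat n n" "unitary_mat U"
    and V: "V \<in> carrier_mat n n" "unitary_mat V"
    and D: "D \<in> carrier_mat n n" and E: "E \<in> carrier_mat n n"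
  shows "frobenius_norm (U * D * mat_adjoint V - U * E * mat_adjoint V) = frobenius_norm (D - E)"
proof -
  have V': "mat_adjoint V \<in> carrier_mat n n"
    using V by simp
  have UDE: "U * D \<in> carrier_mat n n" "U * E \<in> carrier_mat n n" "D - E \<in> carrier_mat n n"
      "U * (D - E) \<in> carrier_mat n n"
    using U D E by auto
  have "U * D * mat_adjoint V - U * E * mat_adjoint V = U * (D - E) * mat_adjoint V"
    by (simp only: minus_mult_distrib_mat[OF UDE(1,2) V'] mult_minus_distrib_mat[OF U(1) D E])
  then show ?thesis
    by (simp only: frobenius_norm_unitary_right[OF V UDE(4)] frobenius_norm_unitary_left[OF U UDE(3)])
qed

theorem theorem9:
  fixes n k k_plus k_minus :: nat
    and A U V A_hat :: "complex mat"
    and \<sigma> \<sigma>_hat :: "nat \<Rightarrow> real"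
  assumes "A \<in> carrier_mat n n"
    and "U \<in> carrier_mat n n" and "unitary_mat U"
    and "V \<in> carrier_mat n n" and "unitary_mat V"
    and "A = U * diag_of n \<sigma> * mat_adjoint V"
    and "\<forall>i j. 1 \<le> i \<and> i \<le> j \<and> j \<le> n \<longrightarrow> \<sigma> i \<ge> \<sigma> j"
    and "\<forall>i\<in>{1..n}. \<sigma> i \<ge> 0"
    and "k \<le> n"
    and "k_plus = card {i \<in> {1..n}. \<sigma> i > 1}"
    and "k_minus = card {i \<in> {1..n}. \<sigma> i < 1}"
    and "\<forall>i\<in>{1..n}. \<sigma>_hat i =
           (if (k < i \<and> i \<le> k_plus) \<or> (n - k_minus < i \<and> i \<le> n - k) then 1 else \<sigma> i)"
    and "A_hat = U * diag_of n \<sigma>_hat * mat_adjoint V"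
  shows "A_hat \<in> unitary_plus_rank n k
    \<and> (\<forall>X \<in> unitary_plus_rank n k. frobenius_norm (A - A_hat) \<le> frobenius_norm (A - X))
    \<and> (frobenius_norm (A - A_hat))\<^sup>2 =
        (\<Sum>i=k+1..k_plus. (\<sigma> i - 1)\<^sup>2) + (\<Sum>i=n-k_minus+1..n-k. (\<sigma> i - 1)\<^sup>2)"
proof -
  note U = assms(2,3) and V = assms(4,5) and k = \<open>k \<le> n\<close>
  have V': "mat_adjoint V \<in> carrier_mat n n" "unitary_mat (mat_adjoint V)"
    using V by (auto intro: unitary_mat_adjoint)
  have U': "mat_adjoint U \<in> carrier_mat n n" "unitary_mat (mat_adjoint U)"
    using U by (auto intro: unitary_mat_adjoint)
  have anti: "\<sigma> j \<le> \<sigma> i" if "1 \<le> i" "i \<le> j" "j \<le> n" for i j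
    using assms(7) that by blast
  have nonneg: "0 \<le> \<sigma> i" if "i \<in> {1..n}" for i
    using assms(8) that by blast
  have hat: "\<sigma>_hat i = (if i \<in> {k+1..k_plus} \<union> {n-k_minus+1..n-k} then 1 else \<sigma> i)"
    if "i \<in> {1..n}" for i
    using assms(12) that by (auto simp: Suc_le_eq)
  have large: "{i \<in> {1..n}. \<sigma> i > 1} = {1..k_plus}"
    unfolding assms(10)
  proof (rule downward_closed_eq_atLeastAtMost_card[of _ n])
    show "i \<in> {i \<in> {1..n}. \<sigma> i > 1}" if "1 \<le> i" "i \<le> j" "j \<in> {i \<in> {1..n}. \<sigma> i > 1}" for i j
      using that anti[of i j] by auto
  qed auto
  have small: "{i \<in> {1..n}. \<sigma> i < 1} = {n - k_minus + 1..n}"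
    unfolding assms(11)
  proof (rule upward_closed_eq_atLeastAtMost_card)
    show "j \<in> {i \<in> {1..n}. \<sigma> i < 1}" if "i \<in> {i \<in> {1..n}. \<sigma> i < 1}" "i \<le> j" "j \<le> n" for i j
      using that anti[of i j] by auto
  qed auto
  have "k_plus + k_minus = card ({i \<in> {1..n}. \<sigma> i > 1} \<union> {i \<in> {1..n}. \<sigma> i < 1})"
    unfolding assms(10,11) by (intro card_Un_disjoint[symmetric]) auto
  also have "\<dots> \<le> card {1..n}"
    by (intro card_mono) auto
  finally have pm: "k_plus + k_minus \<le> n"
    by simp
  have gt: "\<sigma> i > 1 \<longleftrightarrow> i \<le> k_plus" if "i \<in> {1..n}" for i
    using eqset_imp_iff[OF large, of i] that by simp
  have lt: "\<sigma> i < 1 \<longleftrightarrow> n - k_minus < i" if "i \<in> {1..n}" for i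
    using eqset_imp_iff[OF small, of i] that by (simp add: Suc_le_eq)
  let ?sum = "(\<Sum>i=k+1..k_plus. (\<sigma> i - 1)\<^sup>2) + (\<Sum>i=n-k_minus+1..n-k. (\<sigma> i - 1)\<^sup>2)"

  have frob: "frobenius_norm (A - U * D * mat_adjoint V) = frobenius_norm (diag_of n \<sigma> - D)"
    if "D \<in> carrier_mat n n" for D
    unfolding assms(6) using that by (rule frobenius_norm_unitary_equivalence[OF U V diag_of_carrier])

  have "diag_of n \<sigma>_hat \<in> unitary_plus_rank n k"
    unfolding diag_of_def
  proof (rule diag_unitary_plus_rank[where p = "min k k_plus" and m = "min k k_minus"])
    show "1 < \<sigma>_hat (Suc i)" if "i < min k k_plus" for i
    proof -
      have i: "Suc i \<in> {1..n}"
        using that k by auto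
      show ?thesis
        using hat[OF i] gt[OF i] that pm by auto
    qed
    show "0 \<le> \<sigma>_hat (Suc i) \<and> \<sigma>_hat (Suc i) < 1" if "n - min k k_minus \<le> i" "i < n" for i
    proof -
      have i: "Suc i \<in> {1..n}"
        using that by auto
      show ?thesis
        using hat[OF i] lt[OF i] nonneg[OF i] that pm by auto
    qed
    show "\<sigma>_hat (Suc i) = 1" if "min k k_plus \<le> i" "i < n - min k k_minus" for i
    proof -
      have i: "Suc i \<in> {1..n}"
        using that by auto
      show ?thesis
        using hat[OF i] gt[OF i] lt[OF i] that
        by (cases "\<sigma> (Suc i)" "1 :: real" rule: linorder_cases) auto
    qed
  qed (use pm in auto)
  then have member: "A_hat \<in> unitary_plus_rank n k"
    unfolding assms(13) by (rule unitary_plus_rank_mult[OF U V'])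

  have error: "(frobenius_norm (A - A_hat))\<^sup>2 = ?sum"
  proof -
    have "(frobenius_norm (A - A_hat))\<^sup>2 = (\<Sum>i=1..n. (\<sigma> i - \<sigma>_hat i)\<^sup>2)"
      unfolding assms(13) by (simp add: frob frobenius_norm_diag_diff_square)
    also have "\<dots> = (\<Sum>i\<in>{k+1..k_plus} \<union> {n-k_minus+1..n-k}. (\<sigma> i - \<sigma>_hat i)\<^sup>2)"
    proof (rule sum.mono_neutral_right)
      show "\<forall>i\<in>{1..n} - ({k+1..k_plus} \<union> {n-k_minus+1..n-k}). (\<sigma> i - \<sigma>_hat i)\<^sup>2 = 0"
      proof
        fix i assume i: "i \<in> {1..n} - ({k+1..k_plus} \<union> {n-k_minus+1..n-k})"
        then have "i \<in> {1..n}" "i \<notin> {k+1..k_plus} \<union> {n-k_minus+1..n-k}"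
          by (simp_all only: Diff_iff not_False_eq_True)
        then have "\<sigma>_hat i = \<sigma> i"
          using hat[of i] by (simp only: if_False)
        then show "(\<sigma> i - \<sigma>_hat i)\<^sup>2 = 0"
          by simp
      qed
    qed (use pm in auto)
    also have "\<dots> = (\<Sum>i\<in>{k+1..k_plus} \<union> {n-k_minus+1..n-k}. (\<sigma> i - 1)\<^sup>2)"
    proof (rule sum.cong)
      fix i assume i: "i \<in> {k+1..k_plus} \<union> {n-k_minus+1..n-k}"
      then have "i \<in> {1..n}"
        using pm by auto
      then have "\<sigma>_hat i = 1"
        using hat[of i] i by (simp only: if_True)
      then show "(\<sigma> i - \<sigma>_hat i)\<^sup>2 = (\<sigma> i - 1)\<^sup>2"
        by simp
    qed (rule refl)
    also have "\<dots> = ?sum"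
      using pm by (intro sum.union_disjoint) auto
    finally show ?thesis .
  qed

  have "frobenius_norm (A - A_hat) \<le> frobenius_norm (A - X)" if X: "X \<in> unitary_plus_rank n k" for X
  proof -
    define Y where "Y = mat_adjoint U * X * V"
    have Y: "Y \<in> unitary_plus_rank n k"
      unfolding Y_def by (rule unitary_plus_rank_mult[OF U' V X])
    have Xc: "X \<in> carrier_mat n n" and Yc: "Y \<in> carrier_mat n n"
      using X Y by (auto intro: unitary_plus_rank_carrier)
    have XV: "X * V \<in> carrier_mat n n"
      using Xc V by auto
    have "U * Y = U * mat_adjoint U * (X * V)"
      unfolding Y_def using assoc_mult_mat[OF U'(1) Xc V(1)] assoc_mult_mat[OF U(1) U'(1) XV] by simp
    also have "\<dots> = X * V"
      by (simp only: unitary_mat_adjoint_right[OF U] left_mult_one_mat[OF XV])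
    finally have "U * Y * mat_adjoint V = X * (V * mat_adjoint V)"
      using assoc_mult_mat[OF Xc V(1) V'(1)] by simp
    also have "\<dots> = X"
      by (simp only: unitary_mat_adjoint_right[OF V] right_mult_one_mat[OF Xc])
    finally have eq: "frobenius_norm (A - X) = frobenius_norm (diag_of n \<sigma> - Y)"
      using frob[OF Yc] by simp
    have le: "(frobenius_norm (A - A_hat))\<^sup>2 \<le> (frobenius_norm (diag_of n \<sigma> - Y))\<^sup>2"
      unfolding error
    proof (rule diag_distance_lower_bound[OF Y])
      show "1 \<le> \<sigma> i" if "i \<in> {1..k_plus}" for i
        using that gt[of i] pm by auto
      show "\<sigma> i \<le> 1" if "i \<in> {n-k_minus+1..n}" for i
        using that lt[of i] pm by auto
    qed (use anti nonneg pm in auto)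
    show ?thesis
      unfolding eq by (rule power2_le_imp_le[OF le frobenius_norm_nonneg])
  qed
  then show ?thesis
    using member error by blast
qed

end
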